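(* Let $G\leq\mathrm{GL}(d,\mathbb{R})$ be a finite group for which generating points exist. For every generating point $v$ we have \[\mathrm{LinSym}((gX)_{g\in G})\leq\mathrm{LinSym}((gv)_{g\in G}).\] The set of generating points $v$ such that $\mathrm{LinSym}((gX)_{g\in G})<\mathrm{LinSym}((gv)_{g\in G})$ (proper containment) is a proper algebraic subset of the set of all generating points, i.e., it is a proper subset of the set of generating points and it is the intersection of the set of generating points with the common zero set of some polynomials in $\mathbb{R}[X_1,\dotsc,X_d]$.
   Context: A point $v\in\mathbb{R}^d$ is a generating point for $G$ if the affine hull of $\{gv\mid g\in G\}$ is $\mathbb{R}^d$. For a field $K$, a finite set $I$ and a family $(v_i)_{i\in I}$ of vectors in $K^d$, put $\mathrm{LinSym}((v_i)_i)=\{\sigma\in\mathrm{Sym}(I)\mid \exists A\in\mathrm{GL}(d,K)\ \forall i\in I:\ Av_i=v_{\sigma(i)}\}$. $X=(X_1,\dotsc,X_d)^t$ is a vector of indeterminates, viewed as an element of $K^d$ with $K=\mathbb{R}(X_1,\dotsc,X_d)$; since $G\leq\mathrm{GL}(d,\mathbb{R})\leq\mathrm{GL}(d,K)$, $(gX)_{g\in G}$ is a family of vectors in $K^d$ indexed by $G$, and $\mathrm{LinSym}((gX)_{g\in G})$ is computed over $K$, while $\mathrm{LinSym}((gv)_{g\in G})$ is computed over $\mathbb{R}$. Both are subgroups of $\mathrm{Sym}(G)$. *)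

theory Defs
  imports
    "HOL-Analysis.Analysis"
    "HOL-Algebra.Bij"
    "HOL-Library.Poly_Mapping"
    "HOL-Computational_Algebra.Polynomial_Factorial"
begin

definition GL :: "('a::field ^ 'n ^ 'n) monoid" where
  "GL = \<lparr>carrier = {A. invertible A}, monoid.mult = (**), one = mat 1\<rparr>"

(* Sym(I) is the library's group BijGroup I: its elements are the bijections of I,
   extended by undefined outside I. *)
definition LinSym :: "'i set \<Rightarrow> ('i \<Rightarrow> 'a::field ^ 'n) \<Rightarrow> ('i \<Rightarrow> 'i) set" where
  "LinSym I v =
     {\<sigma> \<in> carrier (BijGroup I). \<exists>A \<in> carrier GL. \<forall>i\<in>I. A *v v i = v (\<sigma> i)}"

definition generating_point :: "(real ^ 'n ^ 'n) set \<Rightarrow> real ^ 'n \<Rightarrow> bool" where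
  "generating_point G v \<longleftrightarrow> affine hull {g *v v | g. g \<in> G} = UNIV"

(* The polynomial ring R[X_i | i :: 'n]: a monomial is the finitely supported family of its
   exponents, a polynomial the finitely supported family of its coefficients. *)
type_synonym 'n mpoly = "('n \<Rightarrow>\<^sub>0 nat) \<Rightarrow>\<^sub>0 real"

definition mpoly_eval :: "'n::finite mpoly \<Rightarrow> real ^ 'n \<Rightarrow> real" where
  "mpoly_eval p v =
     (\<Sum>m\<in>Poly_Mapping.keys p. Poly_Mapping.lookup p m * (\<Prod>i\<in>UNIV. (v $ i) ^ Poly_Mapping.lookup m i))"

(* The field R(X_i | i :: 'n). The linear order on the index type is only there because the
   library proves that polynomial mappings form an integral domain by means of a monomial order. *)
type_synonym 'n mratfun = "'n mpoly fract"

definition mconst :: "real \<Rightarrow> 'n::{finite,linorder} mratfun" where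
  "mconst c = to_fract (Poly_Mapping.single 0 c)"

definition mvar :: "'n::{finite,linorder} \<Rightarrow> 'n mratfun" where
  "mvar i = to_fract (Poly_Mapping.single (Poly_Mapping.single i 1) 1)"

definition generic_point :: "('n::{finite,linorder} mratfun, 'n) vec" where
  "generic_point = (\<chi> i. mvar i)"

lemma group_GL: "group (GL :: ('a::field ^ 'n ^ 'n) monoid)"
proof (rule groupI)
  fix x :: "'a ^ 'n ^ 'n"
  assume "x \<in> carrier GL"
  then obtain y where y: "x ** y = mat 1" "y ** x = mat 1"
    by (auto simp: GL_def invertible_def)
  then show "\<exists>y\<in>carrier GL. y \<otimes>\<^bsub>GL\<^esub> x = \<one>\<^bsub>GL\<^esub>"
    by (auto simp: GL_def invertible_def)
qed (auto simp: GL_def invertible_mult matrix_mul_assoc, auto simp: invertible_def)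

lemma subgroup_LinSym: "subgroup (LinSym I v) (BijGroup I)"
proof (rule group.subgroupI)
  show "group (BijGroup I)"
    by (rule group_BijGroup)
  show "LinSym I v \<subseteq> carrier (BijGroup I)"
    by (auto simp: LinSym_def)
  have "(\<lambda>x\<in>I. x) \<in> LinSym I v"
    using group.is_monoid[OF group_BijGroup, of I, THEN monoid.one_closed]
    by (auto simp: LinSym_def BijGroup_def GL_def invertible_def intro!: exI[of _ "mat 1"])
  then show "LinSym I v \<noteq> {}" by blast
next
  fix s assume s: "s \<in> LinSym I v"
  then have sB: "s \<in> Bij I" by (auto simp: LinSym_def BijGroup_def)
  then have bij: "bij_betw s I I" by (simp add: Bij_def)
  obtain A B where A: "\<And>i. i \<in> I \<Longrightarrow> A *v v i = v (s i)" and AB: "A ** B = mat 1" "B ** A = mat 1"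
    using s by (auto simp: LinSym_def GL_def invertible_def)
  have "B *v v i = v (inv_into I s i)" if "i \<in> I" for i
  proof -
    have "inv_into I s i \<in> I" "s (inv_into I s i) = i"
      using bij that by (auto simp: bij_betw_def intro: inv_into_into f_inv_into_f)
    then show ?thesis
      by (metis A AB(2) matrix_vector_mul_assoc matrix_vector_mul_lid)
  qed
  then have "restrict (inv_into I s) I \<in> LinSym I v"
    using AB restrict_inv_into_Bij[OF sB]
    by (auto simp: LinSym_def BijGroup_def GL_def invertible_def)
  then show "inv\<^bsub>BijGroup I\<^esub> s \<in> LinSym I v"
    using sB by (simp add: inv_BijGroup)
next
  fix s t assume s: "s \<in> LinSym I v" and t: "t \<in> LinSym I v"
  then have st: "s \<in> Bij I" "t \<in> Bij I" by (auto simp: LinSym_def BijGroup_def)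
  obtain A B where "invertible A" "\<And>i. i \<in> I \<Longrightarrow> A *v v i = v (s i)"
      and "invertible B" "\<And>i. i \<in> I \<Longrightarrow> B *v v i = v (t i)"
    using s t by (auto simp: LinSym_def GL_def)
  moreover have "t i \<in> I" if "i \<in> I" for i
    using st(2) that by (auto simp: Bij_def bij_betw_def)
  ultimately have "invertible (A ** B)" "\<And>i. i \<in> I \<Longrightarrow> (A ** B) *v v i = v (compose I s t i)"
    by (auto simp: invertible_mult compose_eq simp flip: matrix_vector_mul_assoc)
  then show "s \<otimes>\<^bsub>BijGroup I\<^esub> t \<in> LinSym I v"
    using st compose_Bij[OF st] by (auto simp: LinSym_def BijGroup_def GL_def)
qed

end

theory Submission
  imports Defs
begin

text \<open>
  Fix \<open>t\<close> such that the vectors \<open>t\<^sub>j v\<close> form a basis. By Cramer's rule a permutation \<open>\<sigma>\<close> lies in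
  \<open>LinSym (gv)\<close> if and only if finitely many polynomial expressions in the coordinates of \<open>v\<close> vanish,
  and the same expressions, read in the rational function field, decide membership in
  \<open>LinSym (gX)\<close>. An identity between polynomials can be specialized to any point \<open>v\<close>, which gives
  the inclusion. Conversely, for each \<open>\<sigma>\<close> outside \<open>LinSym (gX)\<close> some expression is a nonzero
  polynomial; the product of these over the finitely many such \<open>\<sigma>\<close> with the basis determinant is
  nonzero at some point, and that point is generating because a spanning orbit whose sum is zero
  is also affinely spanning. The bad set is the union over these \<open>\<sigma>\<close> of finitely many zero sets.
\<close>

section \<open>Polynomial functions\<close>

lemma mpoly_eval_superset:
  assumes "finite S" "Poly_Mapping.keys p \<subseteq> S"
  shows "mpoly_eval p v =
    (\<Sum>m\<in>S. Poly_Mapping.lookup p m * (\<Prod>i\<in>UNIV. (v $ i) ^ Poly_Mapping.lookup m i))"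
  unfolding mpoly_eval_def
  using assms by (intro sum.mono_neutral_left) (auto simp: in_keys_iff)

lemma mpoly_eval_single [simp]:
  "mpoly_eval (Poly_Mapping.single m c) v = c * (\<Prod>i\<in>UNIV. (v $ i) ^ Poly_Mapping.lookup m i)"
  by (subst mpoly_eval_superset[of "{m}"]) auto

lemma mpoly_eval_0 [simp]: "mpoly_eval 0 v = 0"
  by (simp add: mpoly_eval_def)

lemma mpoly_eval_1 [simp]: "mpoly_eval 1 v = 1"
  using mpoly_eval_single[of 0 1 v] by (simp del: mpoly_eval_single)

lemma mpoly_eval_add [simp]: "mpoly_eval (p + q) v = mpoly_eval p v + mpoly_eval q v"
proof -
  let ?S = "Poly_Mapping.keys p \<union> Poly_Mapping.keys q"
  have "mpoly_eval r v =
      (\<Sum>m\<in>?S. Poly_Mapping.lookup r m * (\<Prod>i\<in>UNIV. (v $ i) ^ Poly_Mapping.lookup m i))"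
    if "r \<in> {p, q, p + q}" for r
    by (rule mpoly_eval_superset) (use that Poly_Mapping.keys_add[of p q] in auto)
  then show ?thesis
    by (simp add: lookup_add distrib_right sum.distrib)
qed

lemma mpoly_eval_sum [simp]: "mpoly_eval (sum f A) v = (\<Sum>a\<in>A. mpoly_eval (f a) v)"
  by (induction A rule: infinite_finite_induct) auto

lemma poly_mapping_eq_sum_single:
  "p = (\<Sum>m\<in>Poly_Mapping.keys p. Poly_Mapping.single m (Poly_Mapping.lookup p m))"
proof (rule poly_mapping_eqI)
  fix k
  show "Poly_Mapping.lookup p k =
    Poly_Mapping.lookup (\<Sum>m\<in>Poly_Mapping.keys p. Poly_Mapping.single m (Poly_Mapping.lookup p m)) k"
    by (auto simp: lookup_sum lookup_single when_def sum.delta in_keys_iff)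
qed

lemma mpoly_eval_mult [simp]: "mpoly_eval (p * q) v = mpoly_eval p v * mpoly_eval q v"
proof -
  have "p * q = (\<Sum>m\<in>Poly_Mapping.keys p. \<Sum>n\<in>Poly_Mapping.keys q.
      Poly_Mapping.single (m + n) (Poly_Mapping.lookup p m * Poly_Mapping.lookup q n))"
    by (subst poly_mapping_eq_sum_single[of p], subst poly_mapping_eq_sum_single[of q])
      (simp add: sum_product mult_single)
  then show ?thesis
    by (simp add: mpoly_eval_def[of p] mpoly_eval_def[of q] sum_product lookup_add power_add
        prod.distrib mult_ac)
qed

text \<open>Rescaling one coordinate by 2 multiplies distinct monomials by distinct factors, so a
  vanishing combination can be shortened by one monomial.\<close>
lemma monomials_linearly_independent:
  fixes c :: "('n::finite \<Rightarrow>\<^sub>0 nat) \<Rightarrow> real"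
  assumes "finite S"
    and "\<And>v :: real ^ 'n. (\<Sum>m\<in>S. c m * (\<Prod>i\<in>UNIV. (v $ i) ^ Poly_Mapping.lookup m i)) = 0"
    and "m \<in> S"
  shows "c m = 0"
  using assms
proof (induction S arbitrary: c m rule: finite_induct)
  case empty
  then show ?case by simp
next
  case (insert n S)
  let ?e = "\<lambda>m (v :: real ^ 'n). \<Prod>i\<in>UNIV. (v $ i) ^ Poly_Mapping.lookup m i"
  have scale: "c m * (2 ^ Poly_Mapping.lookup m k - 2 ^ Poly_Mapping.lookup n k) = 0"
    if "m \<in> S" for m k
  proof (rule insert.IH[OF _ that])
    fix v :: "real ^ 'n"
    let ?w = "\<chi> i. (if i = k then 2 else 1) * v $ i"
    have w: "?e m ?w = 2 ^ Poly_Mapping.lookup m k * ?e m v" for m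
    proof -
      have "?e m ?w = (\<Prod>i\<in>UNIV. (if i = k then 2 else 1) ^ Poly_Mapping.lookup m i) * ?e m v"
        by (simp add: power_mult_distrib prod.distrib)
      also have "(\<Prod>i\<in>UNIV. (if i = k then 2 else 1 :: real) ^ Poly_Mapping.lookup m i) =
          (\<Prod>i\<in>UNIV. if i = k then 2 ^ Poly_Mapping.lookup m i else 1)"
        by (rule prod.cong) auto
      finally show ?thesis by simp
    qed
    \<comment> \<open>Subtracting this multiple of the relation at \<open>v\<close> from the
      relation at \<open>?w\<close> cancels the term of \<open>n\<close>.\<close>
    have "(\<Sum>m\<in>insert n S. c m * ?e m ?w) -
        2 ^ Poly_Mapping.lookup n k * (\<Sum>m\<in>insert n S. c m * ?e m v) = 0"
      by (simp only: insert.prems(1) mult_zero_right diff_0_right)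
    then have "(\<Sum>m\<in>S. c m * ?e m ?w) - 2 ^ Poly_Mapping.lookup n k * (\<Sum>m\<in>S. c m * ?e m v) = 0"
      using insert.hyps unfolding w by (simp add: algebra_simps)
    then show "(\<Sum>m\<in>S. c m * (2 ^ Poly_Mapping.lookup m k - 2 ^ Poly_Mapping.lookup n k) * ?e m v) = 0"
      unfolding w by (simp add: sum_distrib_left algebra_simps sum_subtractf)
  qed
  have S: "c m = 0" if m: "m \<in> S" for m
  proof -
    have "m \<noteq> n" using m insert.hyps by auto
    then obtain k where "Poly_Mapping.lookup m k \<noteq> Poly_Mapping.lookup n k"
      by (meson poly_mapping_eqI)
    then show ?thesis
      using scale[OF m, of k] by simp
  qed
  \<comment> \<open>At the all-ones point every monomial has value 1, so the relation reduces to
    \<open>c n\<close>.\<close>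
  then have "c n = 0"
    using insert.prems(1)[of "\<chi> i. 1"] insert.hyps by simp
  with S insert.prems(2) show ?case by auto
qed

lemma mpoly_eval_nonzero:
  fixes p :: "'n::finite mpoly"
  assumes "p \<noteq> 0"
  obtains v where "mpoly_eval p v \<noteq> 0"
proof -
  have "p = 0" if "\<And>v. mpoly_eval p v = 0"
  proof (rule poly_mapping_eqI)
    fix m
    show "Poly_Mapping.lookup p m = Poly_Mapping.lookup 0 m"
      using monomials_linearly_independent[of "Poly_Mapping.keys p" "Poly_Mapping.lookup p" m]
        that[unfolded mpoly_eval_def] by (cases "m \<in> Poly_Mapping.keys p") (auto simp: in_keys_iff)
  qed
  with assms that show ?thesis by blast
qed

section \<open>Cramer's rule for linear symmetries\<close>

definition frame :: "('i \<Rightarrow> 'a ^ 'n) \<Rightarrow> ('n \<Rightarrow> 'i) \<Rightarrow> 'a ^ 'n ^ 'n" where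
  "frame v t = (\<chi> i j. v (t j) $ i)"

text \<open>If \<open>A\<close> maps each \<open>v (t k)\<close> to \<open>v (\<sigma> (t k))\<close>, then this is the \<open>i\<close>-th coordinate of
  \<open>A (v g) - v (\<sigma> g)\<close> multiplied by \<open>det (frame v t)\<close>.\<close>
definition defect ::
  "('i \<Rightarrow> 'a::comm_ring_1 ^ 'n) \<Rightarrow> ('n \<Rightarrow> 'i) \<Rightarrow> ('i \<Rightarrow> 'i) \<Rightarrow> 'i \<Rightarrow> 'n \<Rightarrow> 'a" where
  "defect v t \<sigma> g i =
     (\<Sum>k\<in>UNIV. v (\<sigma> (t k)) $ i * det (\<chi> a j. if j = k then v g $ a else v (t j) $ a))
       - det (frame v t) * v (\<sigma> g) $ i"

lemma matrix_mult_frame: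
  assumes "\<And>j. A *v v (t j) = v (s j)"
  shows "A ** frame v t = frame v s"
  using assms by (simp add: frame_def vec_eq_iff matrix_matrix_mult_def matrix_vector_mult_def)

text \<open>The only candidate for \<open>A\<close> is the matrix prescribed by its values on the
  basis \<open>v (t j)\<close>; the defects measure its failure on the other vectors. Its
  invertibility follows from surjectivity of \<open>\<sigma>\<close>.\<close>

lemma LinSym_iff_defect:
  fixes v :: "'i \<Rightarrow> 'a::field ^ 'n"
  assumes det: "det (frame v t) \<noteq> 0" and t: "range t \<subseteq> I" and \<sigma>: "\<sigma> \<in> Bij I"
  shows "\<sigma> \<in> LinSym I v \<longleftrightarrow> (\<forall>g\<in>I. \<forall>i. defect v t \<sigma> g i = 0)"
proof -
  let ?M = "frame v t" and ?F = "frame v (\<sigma> \<circ> t)"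
  \<comment> \<open>By Cramer's rule, \<open>c g\<close> is the coordinate vector of
    \<open>v g\<close> in the basis \<open>v (t j)\<close>.\<close>
  define c where
    "c g = (\<chi> k. det (\<chi> a j. if j = k then v g $ a else v (t j) $ a) / det ?M)" for g
  have M: "?M *v c g = v g" for g
    by (subst cramer[OF det]) (simp add: c_def frame_def cong: if_cong)
  have "defect v t \<sigma> g i = det ?M * ((?F *v c g) $ i - v (\<sigma> g) $ i)" for g i
    using det by (simp add: defect_def c_def matrix_vector_mult_def frame_def[of v "\<sigma> \<circ> t"]
        right_diff_distrib sum_distrib_left mult.commute)
  then have defect: "(\<forall>i. defect v t \<sigma> g i = 0) \<longleftrightarrow> ?F *v c g = v (\<sigma> g)" for g
    using det by (simp add: vec_eq_iff)
  have "\<forall>g\<in>I. ?F *v c g = v (\<sigma> g)" if \<sigma>_sym: "\<sigma> \<in> LinSym I v"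
  proof
    fix g assume g: "g \<in> I"
    obtain A where A: "\<And>i. i \<in> I \<Longrightarrow> A *v v i = v (\<sigma> i)"
      using \<sigma>_sym by (auto simp: LinSym_def)
    have "A ** ?M = ?F"
      by (rule matrix_mult_frame) (use A t in auto)
    then have "?F *v c g = A *v (?M *v c g)"
      by (simp add: matrix_vector_mul_assoc)
    then show "?F *v c g = v (\<sigma> g)"
      using A g M by simp
  qed
  moreover have "\<sigma> \<in> LinSym I v" if F: "\<forall>g\<in>I. ?F *v c g = v (\<sigma> g)"
  proof -
    obtain N where N: "N ** ?M = mat 1"
      using det by (auto simp: invertible_det_nz[symmetric] invertible_def)
    define A where "A = ?F ** N"
    have A: "A *v v g = v (\<sigma> g)" if "g \<in> I" for g
    proof -
      have "A *v v g = ?F *v (N *v (?M *v c g))"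
        by (simp add: A_def M matrix_vector_mul_assoc)
      also have "\<dots> = ?F *v c g"
        by (simp add: matrix_vector_mul_assoc N)
      finally show ?thesis using F that by simp
    qed
    \<comment> \<open>Preimages of the \<open>t j\<close> under \<open>\<sigma>\<close> give vectors
      that \<open>A\<close> maps onto the basis, which forces \<open>det A\<close> to be
      nonzero.\<close>
    have "inv_into I \<sigma> (t j) \<in> I \<and> \<sigma> (inv_into I \<sigma> (t j)) = t j" for j
      using \<sigma> t inv_into_into[of "t j" \<sigma> I] f_inv_into_f[of "t j" \<sigma> I]
      by (auto simp: Bij_def bij_betw_def)
    then have "A ** frame v (inv_into I \<sigma> \<circ> t) = ?M"
      by (intro matrix_mult_frame) (use A in auto)
    then have "det A \<noteq> 0"
      using det by (metis det_mul mult_zero_left)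
    then show ?thesis
      using \<sigma> A by (auto simp: LinSym_def GL_def BijGroup_def invertible_det_nz)
  qed
  ultimately show ?thesis
    using defect by blast
qed

lemma finite_Bij:
  assumes "finite I"
  shows "finite (Bij I)"
proof (rule finite_subset)
  show "Bij I \<subseteq> I \<rightarrow>\<^sub>E I"
    by (auto simp: Bij_def PiE_def Pi_def dest: bij_betwE)
  show "finite (I \<rightarrow>\<^sub>E I)"
    using assms by (simp add: finite_PiE)
qed

section \<open>Ring morphisms and determinant expressions\<close>

locale comm_ring_morphism =
  fixes h :: "'a::comm_ring_1 \<Rightarrow> 'b::comm_ring_1"
  assumes hom_one: "h 1 = 1"
    and hom_add: "h (x + y) = h x + h y"
    and hom_mult: "h (x * y) = h x * h y"
begin

lemma hom_zero: "h 0 = 0"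
  using hom_add[of 0 0] by simp

lemma hom_uminus: "h (- x) = - h x"
  using hom_add[of x "- x"] by (simp add: hom_zero add_eq_0_iff)

lemma hom_diff: "h (x - y) = h x - h y"
  using hom_add[of x "- y"] by (simp add: hom_uminus)

lemma hom_sum: "h (sum f A) = (\<Sum>a\<in>A. h (f a))"
  by (induction A rule: infinite_finite_induct) (auto simp: hom_zero hom_add)

lemma hom_prod: "h (prod f A) = (\<Prod>a\<in>A. h (f a))"
  by (induction A rule: infinite_finite_induct) (auto simp: hom_one hom_mult)

lemma hom_det: "h (det A) = det (map_matrix h A)"
proof -
  have "h (of_int (sign p)) = of_int (sign p)" for p :: "'c \<Rightarrow> 'c"
    by (simp add: sign_def hom_one hom_uminus)
  then show ?thesis
    by (simp add: det_def hom_sum hom_mult hom_prod)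
qed

lemma hom_det_frame: "h (det (frame v t)) = det (frame (\<lambda>g. \<chi> i. h (v g $ i)) t)"
  by (simp add: hom_det frame_def map_matrix_def)

text \<open>A defect is free of division, because it carries the factor
  \<open>det (frame v t)\<close>. Hence it commutes with evaluation at a point as well as with the
  embedding into the fraction field.\<close>

lemma hom_defect: "h (defect v t \<sigma> g i) = defect (\<lambda>g. \<chi> i. h (v g $ i)) t \<sigma> g i"
  by (simp add: defect_def hom_diff hom_sum hom_mult hom_det map_matrix_def frame_def
      if_distrib[of h] cong: if_cong)

end

interpretation to_fract: comm_ring_morphism "to_fract :: 'a::idom \<Rightarrow> 'a fract"
  by unfold_locales auto

interpretation mpoly_eval: comm_ring_morphism "\<lambda>p. mpoly_eval p x" for x
  by unfold_locales auto

section \<open>Generating points\<close>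

lemma frame_of_spanning:
  fixes v :: "'i \<Rightarrow> real ^ 'n"
  assumes "span (v ` I) = UNIV"
  obtains t where "range t \<subseteq> I" "det (frame v t) \<noteq> 0"
proof -
  obtain B where B: "B \<subseteq> v ` I" "independent B" "v ` I \<subseteq> span B" "card B = dim (v ` I)"
    using basis_exists by blast
  have span: "span B = UNIV"
    using span_minimal[OF B(3) subspace_span] assms by auto
  have "card B = CARD('n)"
    using B(4) assms dim_span[of "v ` I"] by simp
  moreover have "finite B"
    using B(2) by (rule independent_imp_finite)
  ultimately obtain b where b: "bij_betw b (UNIV :: 'n set) B"
    using finite_same_card_bij[of "UNIV :: 'n set" B] by auto
  \<comment> \<open>The family \<open>v\<close> may repeat vectors, so an index is chosen for each
    basis vector.\<close>
  define t where "t j = inv_into I v (b j)" for j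
  have "b j \<in> v ` I" for j
    using B(1) bij_betwE[OF b] by blast
  then have t: "t j \<in> I" "v (t j) = b j" for j
    unfolding t_def by (rule inv_into_into, rule f_inv_into_f)
  have "columns (frame v t) = B"
    using b by (auto simp: columns_def column_def frame_def t(2) bij_betw_def image_def)
  then have "invertible (frame v t)"
    using span matrix_right_invertible_span_columns[of "frame v t"]
    by (metis invertible_right_inverse span_vec_eq)
  then show ?thesis
    using t(1) that by (auto simp: invertible_det_nz)
qed

lemma spanning_of_frame:
  fixes v :: "'i \<Rightarrow> real ^ 'n"
  assumes "range t \<subseteq> I" "det (frame v t) \<noteq> 0"
  shows "span (v ` I) = UNIV"
proof -
  have "span (columns (frame v t)) = UNIV"
    using assms(2) matrix_right_invertible_span_columns[of "frame v t"]
    by (metis invertible_det_nz invertible_right_inverse span_vec_eq)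
  moreover have "columns (frame v t) \<subseteq> v ` I"
    using assms(1) by (auto simp: columns_def column_def frame_def)
  ultimately show ?thesis
    using span_mono by blast
qed

text \<open>The group sum is constant on the orbit of \<open>v\<^sub>0\<close>, hence on its affine hull, hence zero.\<close>
lemma group_sum_eq_0:
  fixes G :: "(real ^ 'n ^ 'n) set"
  assumes G: "subgroup G GL" and v\<^sub>0: "generating_point G v\<^sub>0"
  shows "(\<Sum>g\<in>G. g *v x) = 0"
proof -
  define f where "f x = (\<Sum>g\<in>G. g *v x)" for x :: "real ^ 'n"
  have lin: "linear f"
    unfolding f_def by (intro linear_compose_sum ballI matrix_vector_mul_linear)
  have inv: "f (h *v x) = f x" if h: "h \<in> G" for h x
  proof -
    interpret H: group "GL\<lparr>carrier := G\<rparr>" by (rule subgroup.subgroup_is_group[OF G group_GL])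
    have mem: "g ** h \<in> G" if "g \<in> G" for g
      using subgroup.m_closed[OF G that h] by (simp add: GL_def)
    obtain k where k: "k \<in> G" "k ** h = mat 1" "h ** k = mat 1"
      using H.l_inv_ex[of h] H.r_inv[of h] H.l_inv[of h] H.inv_closed[of h] h by (auto simp: GL_def)
    have mem': "g ** k \<in> G" if "g \<in> G" for g
      using subgroup.m_closed[OF G that k(1)] by (simp add: GL_def)
    have "f (h *v x) = (\<Sum>g\<in>G. (g ** h) *v x)"
      by (simp add: f_def matrix_vector_mul_assoc)
    also have "\<dots> = f x"
      unfolding f_def
      by (rule sum.reindex_bij_witness[of _ "\<lambda>g. g ** k" "\<lambda>g. g ** h"])
        (auto simp: mem mem' k simp flip: matrix_mul_assoc)
    finally show ?thesis .
  qed
  have "affine {x. f x = f v\<^sub>0}"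
    using lin by (auto simp: affine_def linear_add linear_scale simp flip: scaleR_add_left)
  then have "affine hull {g *v v\<^sub>0 | g. g \<in> G} \<subseteq> {x. f x = f v\<^sub>0}"
    by (intro hull_minimal) (auto simp: inv)
  then have "f x = f v\<^sub>0" for x
    using v\<^sub>0 by (auto simp: generating_point_def)
  then have "f x = f 0" by metis
  then show ?thesis
    using linear_0[OF lin] by (simp add: f_def)
qed

text \<open>The barycentre of every orbit is zero by \<open>group_sum_eq_0\<close>, so the affine
  hull of the orbit contains 0 and coincides with its linear span.\<close>

lemma generating_point_iff_span:
  fixes G :: "(real ^ 'n ^ 'n) set"
  assumes G: "subgroup G GL" and fin: "finite G" and ex: "\<exists>v. generating_point G v"
  shows "generating_point G v \<longleftrightarrow> span ((\<lambda>g. g *v v) ` G) = UNIV"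
proof -
  let ?S = "(\<lambda>g. g *v v) ` G"
  have "G \<noteq> {}"
    using subgroup.one_closed[OF G] by auto
  then have "(\<Sum>g\<in>G. (1 / real (card G)) *\<^sub>R (g *v v)) \<in> affine hull ?S"
    using fin by (intro convex_sum affine_imp_convex affine_affine_hull) (auto intro: hull_inc)
  moreover have "(\<Sum>g\<in>G. (1 / real (card G)) *\<^sub>R (g *v v)) = 0"
    using ex group_sum_eq_0[OF G] by (auto simp flip: scaleR_sum_right)
  ultimately have "affine hull ?S = span ?S"
    by (metis affine_hull_span_0)
  moreover have "{g *v v | g. g \<in> G} = ?S"
    by auto
  ultimately show ?thesis
    by (simp add: generating_point_def)
qed

section \<open>Specialization of the generic orbit\<close>

text \<open>The vector \<open>gX\<close> has linear forms as entries. Keeping it over the polynomial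
  ring lets it be mapped both to the function field and to any real point.\<close>

definition generic_orbit ::
  "real ^ 'n::{finite,linorder} ^ 'n::{finite,linorder} \<Rightarrow> ('n mpoly, 'n) vec" where
  "generic_orbit g = (\<chi> i. \<Sum>j\<in>UNIV. Poly_Mapping.single (Poly_Mapping.single j 1) (g $ i $ j))"

lemma to_fract_generic_orbit:
  "(\<lambda>g. \<chi> i. to_fract (generic_orbit g $ i)) = (\<lambda>g. map_matrix mconst g *v generic_point)"
  by (simp add: fun_eq_iff vec_eq_iff generic_orbit_def matrix_vector_mult_def generic_point_def
      mconst_def mvar_def mult_single flip: to_fract_mult)

lemma mpoly_eval_generic_orbit: "(\<lambda>g. \<chi> i. mpoly_eval (generic_orbit g $ i) v) = (\<lambda>g. g *v v)"
proof -
  have "(\<Prod>i\<in>UNIV. (v $ i) ^ Poly_Mapping.lookup (Poly_Mapping.single j 1) i) = v $ j" for j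
  proof -
    have "(\<Prod>i\<in>UNIV. (v $ i) ^ Poly_Mapping.lookup (Poly_Mapping.single j 1) i) =
        (\<Prod>i\<in>UNIV. if i = j then v $ i else 1)"
      by (rule prod.cong) (auto simp: lookup_single when_def)
    then show ?thesis by simp
  qed
  then show ?thesis
    by (simp add: fun_eq_iff vec_eq_iff generic_orbit_def matrix_vector_mult_def)
qed

lemmas to_fract_det_frame =
  to_fract.hom_det_frame[where v = generic_orbit, unfolded to_fract_generic_orbit]
lemmas to_fract_defect =
  to_fract.hom_defect[where v = generic_orbit, unfolded to_fract_generic_orbit]
lemmas mpoly_eval_det_frame =
  mpoly_eval.hom_det_frame[where v = generic_orbit, unfolded mpoly_eval_generic_orbit]
lemmas mpoly_eval_defect =
  mpoly_eval.hom_defect[where v = generic_orbit, unfolded mpoly_eval_generic_orbit]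

text \<open>The polynomial ring embeds into its fraction field, so the defects over the field vanish
  exactly when the polynomial ones do.\<close>

lemma generic_LinSym_iff:
  fixes G :: "(real ^ 'n::{finite,linorder} ^ 'n::{finite,linorder}) set"
  assumes "det (frame generic_orbit t) \<noteq> 0" "range t \<subseteq> G" "\<sigma> \<in> Bij G"
  shows "\<sigma> \<in> LinSym G (\<lambda>g. map_matrix mconst g *v generic_point) \<longleftrightarrow>
    (\<forall>g\<in>G. \<forall>i. defect generic_orbit t \<sigma> g i = 0)"
proof -
  have "det (frame (\<lambda>g. map_matrix mconst g *v generic_point) t) \<noteq> 0"
    using assms(1) by (simp flip: to_fract_det_frame)
  from LinSym_iff_defect[OF this assms(2,3)] show ?thesis
    by (simp flip: to_fract_defect)
qed

lemma LinSym_iff_mpoly_eval_defect: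
  fixes G :: "(real ^ 'n::{finite,linorder} ^ 'n::{finite,linorder}) set"
  assumes "mpoly_eval (det (frame generic_orbit t)) v \<noteq> 0" "range t \<subseteq> G" "\<sigma> \<in> Bij G"
  shows "\<sigma> \<in> LinSym G (\<lambda>g. g *v v) \<longleftrightarrow>
    (\<forall>g\<in>G. \<forall>i. mpoly_eval (defect generic_orbit t \<sigma> g i) v = 0)"
  using LinSym_iff_defect[of "\<lambda>g. g *v v" t G \<sigma>] assms
  by (simp add: mpoly_eval_det_frame mpoly_eval_defect)

section \<open>Inclusion, properness and equations of the bad set\<close>

theorem theorem4p3:
  fixes G :: "(real ^ 'n::{finite,linorder} ^ 'n::{finite,linorder}) set"
  assumes "subgroup G GL"
    and "finite G"
    and "\<exists>v. generating_point G v"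
  defines "LX \<equiv> LinSym G (\<lambda>g. map_matrix mconst g *v generic_point)"
  defines "Gen \<equiv> {v. generating_point G v}"
  defines "Bad \<equiv> {v \<in> Gen. LX \<subset> LinSym G (\<lambda>g. g *v v)}"
  shows "(\<forall>v\<in>Gen. LX \<subseteq> LinSym G (\<lambda>g. g *v v)) \<and>
    Bad \<subset> Gen \<and>
    (\<exists>P :: 'n mpoly set. Bad = Gen \<inter> {v. \<forall>p\<in>P. mpoly_eval p v = 0})"
proof -
  let ?D = "\<lambda>t. det (frame generic_orbit t) :: 'n mpoly"
  let ?Q = "\<lambda>t \<sigma> g i. defect generic_orbit t \<sigma> g i :: 'n mpoly"
  let ?L = "\<lambda>v. LinSym G (\<lambda>g. g *v v)"
  define E where "E = Bij G - LX"
  have finE: "finite E"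
    using finite_Bij[OF assms(2)] by (simp add: E_def)
  have Bij: "LX \<subseteq> Bij G" "?L v \<subseteq> Bij G" for v
    by (auto simp: LX_def LinSym_def BijGroup_def)
  have Gen_iff: "v \<in> Gen \<longleftrightarrow> (\<exists>t. range t \<subseteq> G \<and> mpoly_eval (?D t) v \<noteq> 0)" for v
    using frame_of_spanning[of "\<lambda>g. g *v v" G] spanning_of_frame[of _ G "\<lambda>g. g *v v"]
    unfolding Gen_def mem_Collect_eq generating_point_iff_span[OF assms(1-3)] mpoly_eval_det_frame
    by metis
  have generic: "\<sigma> \<in> LX \<longleftrightarrow> (\<forall>g\<in>G. \<forall>i. ?Q t \<sigma> g i = 0)"
    if "\<sigma> \<in> Bij G" "range t \<subseteq> G" "?D t \<noteq> 0" for \<sigma> t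
    unfolding LX_def by (rule generic_LinSym_iff) (use that in auto)
  have incl: "LX \<subseteq> ?L v" if v: "v \<in> Gen" for v
  proof
    fix \<sigma> assume \<sigma>: "\<sigma> \<in> LX"
    obtain t where t: "range t \<subseteq> G" "mpoly_eval (?D t) v \<noteq> 0"
      using v Gen_iff by blast
    \<comment> \<open>A basis at \<open>v\<close> is thus also a basis at the generic point, and the
      same \<open>t\<close> serves both criteria.\<close>
    then have "?D t \<noteq> 0" by auto
    with \<sigma> t Bij(1) have "\<forall>g\<in>G. \<forall>i. ?Q t \<sigma> g i = 0"
      using generic by blast
    then show "\<sigma> \<in> ?L v"
      using LinSym_iff_mpoly_eval_defect[OF t(2,1)] \<sigma> Bij(1) by auto
  qed
  \<comment> \<open>Given the inclusion, a point is bad exactly when some non-generic permutation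
    becomes a symmetry there.\<close>
  have Bad_iff: "v \<in> Bad \<longleftrightarrow> v \<in> Gen \<and> (\<exists>\<sigma>\<in>E. \<sigma> \<in> ?L v)" for v
    using incl[of v] Bij(2)[of v] by (auto simp: Bad_def E_def)

  have "\<exists>v\<in>Gen. v \<notin> Bad"
  proof -
    obtain v\<^sub>0 where "v\<^sub>0 \<in> Gen"
      using assms(3) by (auto simp: Gen_def)
    then obtain t where t: "range t \<subseteq> G" "mpoly_eval (?D t) v\<^sub>0 \<noteq> 0"
      using Gen_iff by blast
    then have D: "?D t \<noteq> 0" by auto
    have "\<forall>\<sigma>\<in>E. \<exists>q. q \<noteq> 0 \<and> (\<exists>g\<in>G. \<exists>i. q = ?Q t \<sigma> g i)"
      using generic[OF _ t(1) D] by (fastforce simp: E_def)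
    from bchoice[OF this] obtain q
      where q: "\<And>\<sigma>. \<sigma> \<in> E \<Longrightarrow> q \<sigma> \<noteq> 0 \<and> (\<exists>g\<in>G. \<exists>i. q \<sigma> = ?Q t \<sigma> g i)"
      by blast
    \<comment> \<open>In an integral domain this product is nonzero, so one point avoids all the
      zero sets at once; the factor \<open>?D t\<close> makes that point generating.\<close>
    have "?D t * (\<Prod>\<sigma>\<in>E. q \<sigma>) \<noteq> 0"
      using D q finE by simp
    then obtain v where "mpoly_eval (?D t * (\<Prod>\<sigma>\<in>E. q \<sigma>)) v \<noteq> 0"
      by (rule mpoly_eval_nonzero)
    then have v: "mpoly_eval (?D t) v \<noteq> 0" "\<And>\<sigma>. \<sigma> \<in> E \<Longrightarrow> mpoly_eval (q \<sigma>) v \<noteq> 0"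
      using finE by (auto simp: mpoly_eval.hom_prod)
    have "\<sigma> \<notin> ?L v" if \<sigma>: "\<sigma> \<in> E" for \<sigma>
    proof -
      have "\<exists>g\<in>G. \<exists>i. mpoly_eval (?Q t \<sigma> g i) v \<noteq> 0"
        using q[OF \<sigma>] v(2)[OF \<sigma>] by metis
      then show ?thesis
        using LinSym_iff_mpoly_eval_defect[OF v(1) t(1)] \<sigma> by (auto simp: E_def)
    qed
    with v(1) t(1) show ?thesis
      using Gen_iff Bad_iff by blast
  qed
  moreover have "Bad \<subseteq> Gen"
    by (auto simp: Bad_def)
  ultimately have proper: "Bad \<subset> Gen" by blast

  \<comment> \<open>The factor \<open>?D t\<close> makes the condition void for those \<open>t\<close> that give no basis at \<open>v\<close>.\<close>
  define R where "R \<sigma> = {?D t * ?Q t \<sigma> g i | t g i. range t \<subseteq> G \<and> g \<in> G}" for \<sigma>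
  have R: "\<sigma> \<in> ?L v \<longleftrightarrow> (\<forall>p\<in>R \<sigma>. mpoly_eval p v = 0)" if v: "v \<in> Gen" and \<sigma>: "\<sigma> \<in> E" for v \<sigma>
  proof -
    have iff: "\<sigma> \<in> ?L v \<longleftrightarrow> (\<forall>g\<in>G. \<forall>i. mpoly_eval (?Q t \<sigma> g i) v = 0)"
      if "range t \<subseteq> G" "mpoly_eval (?D t) v \<noteq> 0" for t
      by (rule LinSym_iff_mpoly_eval_defect) (use that \<sigma> in \<open>auto simp: E_def\<close>)
    obtain t where t: "range t \<subseteq> G" "mpoly_eval (?D t) v \<noteq> 0"
      using v Gen_iff by blast
    show ?thesis
    proof
      assume \<sigma>_sym: "\<sigma> \<in> ?L v"
      have "mpoly_eval (?D t * ?Q t \<sigma> g i) v = 0" if "range t \<subseteq> G" "g \<in> G" for t g i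
        using iff[OF that(1)] that(2) \<sigma>_sym by (cases "mpoly_eval (?D t) v = 0") auto
      then show "\<forall>p\<in>R \<sigma>. mpoly_eval p v = 0"
        unfolding R_def by blast
    next
      assume "\<forall>p\<in>R \<sigma>. mpoly_eval p v = 0"
      then have "mpoly_eval (?D t * ?Q t \<sigma> g i) v = 0" if "g \<in> G" for g i
        using t(1) that unfolding R_def by blast
      then show "\<sigma> \<in> ?L v"
        using iff[OF t] t(2) by auto
    qed
  qed
  \<comment> \<open>A finite union of zero sets is cut out by the products with one factor from each
    system \<open>R \<sigma>\<close>. For empty \<open>E\<close> this gives \<open>P = {1}\<close>,
    with no zeros.\<close>
  define P where "P = {\<Prod>\<sigma>\<in>E. p \<sigma> | p. \<forall>\<sigma>\<in>E. p \<sigma> \<in> R \<sigma>}"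
  have "(\<exists>\<sigma>\<in>E. \<sigma> \<in> ?L v) \<longleftrightarrow> (\<forall>p\<in>P. mpoly_eval p v = 0)" if v: "v \<in> Gen" for v
  proof
    assume "\<exists>\<sigma>\<in>E. \<sigma> \<in> ?L v"
    then obtain \<sigma> where \<sigma>: "\<sigma> \<in> E" "\<forall>p\<in>R \<sigma>. mpoly_eval p v = 0"
      using R[OF v] by blast
    then have "\<exists>\<sigma>\<in>E. mpoly_eval (p \<sigma>) v = 0" if "\<forall>\<sigma>\<in>E. p \<sigma> \<in> R \<sigma>" for p
      using that by blast
    then show "\<forall>p\<in>P. mpoly_eval p v = 0"
      using finE by (auto simp: P_def mpoly_eval.hom_prod)
  next
    assume zero: "\<forall>p\<in>P. mpoly_eval p v = 0"
    show "\<exists>\<sigma>\<in>E. \<sigma> \<in> ?L v"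
    proof (rule ccontr)
      assume "\<not> (\<exists>\<sigma>\<in>E. \<sigma> \<in> ?L v)"
      \<comment> \<open>Outside the union each system has a member that does not vanish at
        \<open>v\<close>; their product lies in \<open>P\<close> and is nonzero there.\<close>
      then have "\<forall>\<sigma>\<in>E. \<exists>p. p \<in> R \<sigma> \<and> mpoly_eval p v \<noteq> 0"
        using R[OF v] by blast
      from bchoice[OF this] obtain p
        where p: "\<And>\<sigma>. \<sigma> \<in> E \<Longrightarrow> p \<sigma> \<in> R \<sigma> \<and> mpoly_eval (p \<sigma>) v \<noteq> 0"
        by blast
      then have "mpoly_eval (\<Prod>\<sigma>\<in>E. p \<sigma>) v = 0"
        using zero by (auto simp: P_def)
      then show False
        using p finE by (auto simp: mpoly_eval.hom_prod)
    qed
  qed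
  then have "Bad = Gen \<inter> {v. \<forall>p\<in>P. mpoly_eval p v = 0}"
    using Bad_iff by blast
  with incl proper show ?thesis by blast
qed

end
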